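(* Let $d,m\in\mathbb{N}$. A function $\boldsymbol{\gamma}=(\gamma_{ij})_{i,j=1,\dots,m}:\mathbb{R}^d\to\mathbb{R}^{m\times m}$ is conditionally negative definite if and only if, for all $t>0$, the matrix-valued function $\exp^\ast(-t\boldsymbol{\gamma}):\mathbb{R}^d\to\mathbb{R}^{m\times m}$, defined componentwise by $\exp^\ast(-t\boldsymbol{\gamma}(\boldsymbol{h}))_{ij}:=\exp(-t\gamma_{ij}(\boldsymbol{h}))$, is positive definite.
   Context: Conditionally negative definite: $\boldsymbol{\gamma}:\mathbb{R}^d\to\mathbb{R}^{m\times m}$ is conditionally negative definite if (i) $\gamma_{ij}(\boldsymbol{h})=\gamma_{ji}(-\boldsymbol{h})$ for all $\boldsymbol{h}\in\mathbb{R}^d$, $i,j=1,\dots,m$, and (ii) $\sum_{i=1}^n\sum_{j=1}^n \boldsymbol{a}_i^\top\boldsymbol{\gamma}(\boldsymbol{x}_i-\boldsymbol{x}_j)\boldsymbol{a}_j\le 0$ for all $n\in\mathbb{N}$, $\boldsymbol{x}_1,\dots,\boldsymbol{x}_n\in\mathbb{R}^d$ and $\boldsymbol{a}_1,\dots,\boldsymbol{a}_n\in\mathbb{R}^m$ with $\boldsymbol{1}_m^\top\sum_{k=1}^n\boldsymbol{a}_k=0$, where $\boldsymbol{1}_m=(1,\dots,1)^\top\in\mathbb{R}^m$. Positive definite: $\boldsymbol{C}:\mathbb{R}^d\to\mathbb{R}^{m\times m}$ is positive definite if $C_{ij}(\boldsymbol{h})=C_{ji}(-\boldsymbol{h})$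 for all $\boldsymbol{h}$, $i,j$, and $\sum_{i=1}^n\sum_{j=1}^n \boldsymbol{a}_i^\top\boldsymbol{C}(\boldsymbol{x}_i-\boldsymbol{x}_j)\boldsymbol{a}_j\ge 0$ for all $n\in\mathbb{N}$, $\boldsymbol{x}_1,\dots,\boldsymbol{x}_n\in\mathbb{R}^d$, $\boldsymbol{a}_1,\dots,\boldsymbol{a}_n\in\mathbb{R}^m$. *)

theory Defs
  imports "HOL-Analysis.Analysis"
begin

text \<open>Matrix-valued functions on Euclidean space. The points and the weights are given by
  sequences of which only the first \<open>n\<close> members enter the conditions; neither
  the points nor the weights need be distinct.\<close>

definition conditionally_negative_definite :: "(real^'d \<Rightarrow> real^'m^'m) \<Rightarrow> bool" where
  "conditionally_negative_definite \<gamma> \<longleftrightarrow>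
     (\<forall>h i j. \<gamma> h $ i $ j = \<gamma> (- h) $ j $ i) \<and>
     (\<forall>(n::nat) (x :: nat \<Rightarrow> real^'d) (a :: nat \<Rightarrow> real^'m).
        (vec 1 :: real^'m) \<bullet> (\<Sum>k<n. a k) = 0 \<longrightarrow>
        (\<Sum>i<n. \<Sum>j<n. a i \<bullet> (\<gamma> (x i - x j) *v a j)) \<le> 0)"

definition positive_definite :: "(real^'d \<Rightarrow> real^'m^'m) \<Rightarrow> bool" where
  "positive_definite C \<longleftrightarrow>
     (\<forall>h i j. C h $ i $ j = C (- h) $ j $ i) \<and>
     (\<forall>(n::nat) (x :: nat \<Rightarrow> real^'d) (a :: nat \<Rightarrow> real^'m).
        (\<Sum>i<n. \<Sum>j<n. a i \<bullet> (C (x i - x j) *v a j)) \<ge> 0)"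

text \<open>The entrywise exponential, not the matrix exponential.\<close>

definition exp_star :: "real^'n^'m \<Rightarrow> real^'n^'m" where
  "exp_star A = (\<chi> i j. exp (A $ i $ j))"

end

theory Submission
  imports Defs
begin

text \<open>
  This is Schoenberg's theorem for matrix-valued functions. A pair of a point number \<open>k\<close> and a
  matrix index \<open>i\<close> is treated as a single index, so that the entries \<open>\<gamma> (x k - x l) $ i $ j\<close>
  form one scalar kernel on a finite set; the side condition on the weights says that they sum to
  zero over this set, and the entrywise exponential is the exponential of the kernel. What remains
  is Schoenberg's theorem for a symmetric kernel \<open>K\<close> on a finite set \<open>S\<close>.

  If all \<open>exp (- t K)\<close> are positive semidefinite, then so is \<open>(exp (- t K) - 1) / t\<close> on weights
  of total zero, because such weights annihilate the constant kernel; letting \<open>t\<close> tend to zero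
  gives \<open>- K\<close>.

  Conversely, fix a base point \<open>o\<close> of \<open>S\<close>. Moving the total weight to \<open>o\<close> shows that the
  centred kernel \<open>\<phi> p q = K p o + K o q - K p q - K o o\<close> is positive semidefinite
  (\<open>psd_on_centred\<close>), and
  \<open>exp (- t K p q)\<close> is \<open>exp (t \<phi> p q)\<close> up to a positive constant and a factor of the form
  \<open>f p * f q\<close>, neither of which affects semidefiniteness. Finally, the entrywise exponential of
  a positive semidefinite kernel is positive semidefinite by the power series and the Schur product
  theorem (\<open>psd_on_mult\<close>), which in turn rests on writing a positive semidefinite kernel as a
  Gram matrix (\<open>psd_on_gram\<close>).
\<close>

section \<open>Quadratic forms of kernels on finite sets\<close>

definition quad_form :: "'a set \<Rightarrow> ('a \<Rightarrow> 'a \<Rightarrow> real) \<Rightarrow> ('a \<Rightarrow> real) \<Rightarrow> real" where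
  "quad_form S K c = (\<Sum>p\<in>S. \<Sum>q\<in>S. c p * c q * K p q)"

definition psd_on :: "'a set \<Rightarrow> ('a \<Rightarrow> 'a \<Rightarrow> real) \<Rightarrow> bool" where
  "psd_on S K \<longleftrightarrow> (\<forall>p\<in>S. \<forall>q\<in>S. K p q = K q p) \<and> (\<forall>c. 0 \<le> quad_form S K c)"

definition cnd_on :: "'a set \<Rightarrow> ('a \<Rightarrow> 'a \<Rightarrow> real) \<Rightarrow> bool" where
  "cnd_on S K \<longleftrightarrow> (\<forall>p\<in>S. \<forall>q\<in>S. K p q = K q p) \<and>
     (\<forall>c. sum c S = 0 \<longrightarrow> quad_form S K c \<le> 0)"

lemma psd_onI:
  assumes "\<And>p q. p \<in> S \<Longrightarrow> q \<in> S \<Longrightarrow> K p q = K q p" "\<And>c. 0 \<le> quad_form S K c"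
  shows "psd_on S K"
  using assms unfolding psd_on_def by blast

lemma psd_onD_sym: "psd_on S K \<Longrightarrow> p \<in> S \<Longrightarrow> q \<in> S \<Longrightarrow> K p q = K q p"
  by (auto simp: psd_on_def)

lemma psd_onD_nonneg: "psd_on S K \<Longrightarrow> 0 \<le> quad_form S K c"
  by (simp add: psd_on_def)

lemma quad_form_cong:
  assumes "\<And>p q. p \<in> S \<Longrightarrow> q \<in> S \<Longrightarrow> c p * c q * K p q = d p * d q * L p q"
  shows "quad_form S K c = quad_form S L d"
  unfolding quad_form_def using assms by (intro sum.cong) auto

lemma quad_form_scale: "quad_form S (\<lambda>p q. r * K p q) c = r * quad_form S K c"
  unfolding quad_form_def by (simp add: sum_distrib_left mult_ac)

lemma quad_form_diff:
  "quad_form S (\<lambda>p q. K p q - L p q) c = quad_form S K c - quad_form S L c"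
  unfolding quad_form_def by (simp add: right_diff_distrib sum_subtractf)

lemma quad_form_product: "quad_form S (\<lambda>p q. f p * g q) c = (\<Sum>p\<in>S. c p * f p) * (\<Sum>q\<in>S. c q * g q)"
  unfolding quad_form_def by (simp add: sum_product mult_ac)

lemma quad_form_const: "quad_form S (\<lambda>p q. r) c = r * (sum c S)\<^sup>2"
  using quad_form_product[of S "\<lambda>_. r" "\<lambda>_. 1" c]
  by (simp add: power2_eq_square mult_ac sum_distrib_left)

lemma quad_form_shift_at:
  assumes "finite S" "p0 \<in> S"
  shows "quad_form S K (\<lambda>p. c p - s * of_bool (p = p0)) =
    quad_form S K c - s * (\<Sum>p\<in>S. c p * K p p0) - s * (\<Sum>q\<in>S. c q * K p0 q) + s\<^sup>2 * K p0 p0"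
proof -
  have *: "(\<Sum>q\<in>S. of_bool (q = p0) * f q) = f p0" for f :: "'a \<Rightarrow> real"
    using assms by (simp add: of_bool_def if_distrib[of "\<lambda>x. x * _"] cong: if_cong)
  have "quad_form S K (\<lambda>p. c p - s * of_bool (p = p0)) =
    (\<Sum>p\<in>S. \<Sum>q\<in>S. c p * c q * K p q - s * (of_bool (q = p0) * (c p * K p q))
      - s * (of_bool (p = p0) * (c q * K p q))
      + s\<^sup>2 * (of_bool (p = p0) * (of_bool (q = p0) * K p q)))"
    unfolding quad_form_def by (simp add: algebra_simps power2_eq_square)
  also have "\<dots> = quad_form S K c - s * (\<Sum>p\<in>S. c p * K p p0)
      - s * (\<Sum>q\<in>S. c q * K p0 q) + s\<^sup>2 * K p0 p0"
    by (simp add: quad_form_def sum.distrib sum_subtractf flip: sum_distrib_left)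
       (simp add: *)
  finally show ?thesis .
qed

section \<open>Gram matrices and the Schur product theorem\<close>

lemma psd_on_subset:
  assumes "psd_on T K" "S \<subseteq> T" "finite T"
  shows "psd_on S K"
proof -
  have "quad_form S K c = quad_form T K (\<lambda>p. if p \<in> S then c p else 0)" for c
    unfolding quad_form_def
    using assms(2,3) by (intro sum.mono_neutral_cong_left) auto
  then show ?thesis
    using assms(1,2) psd_onD_sym[OF assms(1)] by (intro psd_onI) (auto simp: psd_onD_nonneg subset_iff)
qed

lemma psd_on_diagonal_nonneg:
  assumes "psd_on S K" "finite S" "p \<in> S"
  shows "0 \<le> K p p"
  using psd_onD_nonneg[OF assms(1), of "\<lambda>q. 0 - (-1) * of_bool (q = p)"]
  unfolding quad_form_shift_at[OF assms(2,3)] by (simp add: quad_form_def)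

text \<open>A quadratic form that is affine along a line and bounded below is constant on that line, so a
  vanishing diagonal entry forces its whole row to vanish.\<close>

lemma psd_on_zero_diagonal:
  assumes "psd_on S K" "finite S" "p \<in> S" "q \<in> S" "K p p = 0"
  shows "K p q = 0"
proof (rule ccontr)
  assume nz: "K p q \<noteq> 0"
  define c where "c = (\<lambda>r. 0 - (-1) * of_bool (r = q) :: real)"
  have row: "(\<Sum>r\<in>S. c r * K p r) = K p q" "(\<Sum>r\<in>S. c r * K r p) = K p q"
    using assms psd_onD_sym[OF assms(1), of p q]
    by (simp_all add: c_def of_bool_def if_distrib[of "\<lambda>x. x * _"] cong: if_cong)
  have "0 \<le> quad_form S K c - s * K p q - s * K p q" for s
    using psd_onD_nonneg[OF assms(1), of "\<lambda>r. c r - s * of_bool (r = p)"]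
    unfolding quad_form_shift_at[OF assms(2,3)] by (simp add: row assms(5))
  \<comment> \<open>At this \<open>s\<close> the affine function takes the value \<open>-1\<close>.\<close>
  from this[of "(quad_form S K c + 1) / (2 * K p q)"] show False
    using nz by (simp add: field_simps)
qed

text \<open>Removing the rank-one part that carries row \<open>p\<close> is one step of Gaussian elimination; the
  form stays nonnegative because it is the value of the original form after optimising over the
  weight at \<open>p\<close>. If \<open>K p p = 0\<close>, division by zero makes the subtracted part vanish.\<close>

lemma psd_on_schur_complement:
  assumes K: "psd_on S K" and S: "finite S" "p \<in> S"
  shows "psd_on S (\<lambda>q r. K q r - K q p * K p r / K p p)"
proof -
  have nonneg: "0 \<le> quad_form S (\<lambda>q r. K q r - K q p * K p r / K p p) c" for c
  proof -
    define u where "u = (\<Sum>q\<in>S. c q * K q p)"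
    have row: "(\<Sum>q\<in>S. c q * K p q) = u"
      unfolding u_def using psd_onD_sym[OF K _ S(2)] by (intro sum.cong) auto
    have "quad_form S (\<lambda>q r. K q r - K q p * K p r / K p p) c = quad_form S K c - u * u / K p p"
      using quad_form_product[of S "\<lambda>q. K q p / K p p" "K p" c]
      by (simp add: quad_form_diff row u_def flip: sum_divide_distrib)
    also have "\<dots> = quad_form S K (\<lambda>q. c q - u / K p p * of_bool (q = p))"
      unfolding quad_form_shift_at[OF S] row
      by (cases "K p p = 0") (auto simp: u_def[symmetric] power2_eq_square)
    finally show ?thesis
      using psd_onD_nonneg[OF K] by simp
  qed
  show ?thesis
    using nonneg psd_onD_sym[OF K] S(2) by (intro psd_onI) (simp_all add: mult.commute)
qed

text \<open>This is the Cholesky decomposition: adding a point \<open>p\<close> to \<open>S\<close> contributes the vector that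
  carries row \<open>p\<close>, and the remaining vectors come from the Schur complement, whose row \<open>p\<close> is zero,
  so they can be extended by zero.\<close>

lemma psd_on_gram:
  assumes "finite S" "psd_on S K"
  shows "\<exists>v. \<forall>p\<in>S. \<forall>q\<in>S. K p q = (\<Sum>k\<in>S. v k p * v k q)"
  using assms
proof (induction S arbitrary: K rule: finite_induct)
  case (insert p S)
  note K = insert.prems
  define L where "L = (\<lambda>q r. K q r - K q p * K p r / K p p)"
  have "psd_on S L"
    unfolding L_def
    by (rule psd_on_subset[OF psd_on_schur_complement[OF K]]) (use insert.hyps in auto)
  then obtain w where w: "\<And>q r. q \<in> S \<Longrightarrow> r \<in> S \<Longrightarrow> L q r = (\<Sum>k\<in>S. w k q * w k r)"
    using insert.IH by blast
  define v where "v = (\<lambda>k q. if k = p then K q p / sqrt (K p p) else if q = p then 0 else w k q)"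
  have dnn: "0 \<le> K p p"
    using psd_on_diagonal_nonneg[OF K] insert.hyps by simp
  have row0: "L p q = 0" "L q p = 0" if "q \<in> insert p S" for q
    using psd_on_zero_diagonal[OF K _ _ that] psd_onD_sym[OF K _ that, of p] insert.hyps(1)
    by (auto simp: L_def)
  have Lv: "L q r = (\<Sum>k\<in>S. v k q * v k r)" if "q \<in> insert p S" "r \<in> insert p S" for q r
  proof (cases "q = p \<or> r = p")
    case True
    then have "(\<Sum>k\<in>S. v k q * v k r) = 0"
      using insert.hyps(2) by (intro sum.neutral) (auto simp: v_def)
    then show ?thesis
      using True row0 that by auto
  next
    case False
    then show ?thesis
      using that w insert.hyps(2) by (auto simp: v_def intro!: sum.cong)
  qed
  have "K q r = (\<Sum>k\<in>insert p S. v k q * v k r)"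
    if qr: "q \<in> insert p S" "r \<in> insert p S" for q r
  proof -
    have "(\<Sum>k\<in>insert p S. v k q * v k r) = K q p * K r p / K p p + L q r"
      using insert.hyps dnn Lv[OF qr] by (simp add: v_def)
    also have "\<dots> = K q r"
      using psd_onD_sym[OF K _ qr(2), of p] by (simp add: L_def)
    finally show ?thesis ..
  qed
  then show ?case by blast
qed simp

text \<open>For a Gram matrix with vectors \<open>v k\<close>, the form of the product is the sum over \<open>k\<close> of the
  form of the other factor at the weights \<open>c p * v k p\<close>.\<close>

lemma psd_on_mult:
  assumes S: "finite S" and K: "psd_on S K" and L: "psd_on S L"
  shows "psd_on S (\<lambda>p q. K p q * L p q)"
proof -
  obtain v where v: "\<And>p q. p \<in> S \<Longrightarrow> q \<in> S \<Longrightarrow> K p q = (\<Sum>k\<in>S. v k p * v k q)"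
    using psd_on_gram[OF S K] by blast
  have "quad_form S (\<lambda>p q. K p q * L p q) c = (\<Sum>k\<in>S. quad_form S L (\<lambda>p. c p * v k p))" for c
  proof -
    have "quad_form S (\<lambda>p q. K p q * L p q) c =
        (\<Sum>p\<in>S. \<Sum>q\<in>S. \<Sum>k\<in>S. c p * v k p * (c q * v k q) * L p q)"
      unfolding quad_form_def
      by (intro sum.cong refl) (simp add: v sum_distrib_left sum_distrib_right mult_ac)
    also have "\<dots> = (\<Sum>p\<in>S. \<Sum>k\<in>S. \<Sum>q\<in>S. c p * v k p * (c q * v k q) * L p q)"
      by (intro sum.cong refl sum.swap)
    also have "\<dots> = (\<Sum>k\<in>S. quad_form S L (\<lambda>p. c p * v k p))"
      unfolding quad_form_def by (rule sum.swap)
    finally show ?thesis .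
  qed
  then have nonneg: "0 \<le> quad_form S (\<lambda>p q. K p q * L p q) c" for c
    using psd_onD_nonneg[OF L] by (simp add: sum_nonneg)
  show ?thesis
    by (intro psd_onI nonneg arg_cong2[where f = times] psd_onD_sym[OF K] psd_onD_sym[OF L])
qed

lemma psd_on_power:
  assumes "finite S" "psd_on S K"
  shows "psd_on S (\<lambda>p q. K p q ^ n)"
proof (induction n)
  case 0
  show ?case
    by (simp add: psd_on_def quad_form_const)
next
  case (Suc n)
  then show ?case
    using psd_on_mult[OF assms Suc] by simp
qed

lemma psd_on_exp:
  assumes S: "finite S" and K: "psd_on S K"
  shows "psd_on S (\<lambda>p q. exp (K p q))"
proof -
  have nonneg: "0 \<le> quad_form S (\<lambda>p q. exp (K p q)) c" for c
  proof (rule sums_le[OF _ sums_zero])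
    show "(\<lambda>n. quad_form S (\<lambda>p q. K p q ^ n /\<^sub>R fact n) c) sums quad_form S (\<lambda>p q. exp (K p q)) c"
      unfolding quad_form_def by (intro sums_sum sums_mult exp_converges)
    show "0 \<le> quad_form S (\<lambda>p q. K p q ^ n /\<^sub>R fact n) c" for n
      using psd_onD_nonneg[OF psd_on_power[OF S K]]
      by (simp add: quad_form_scale)
  qed
  show ?thesis
    by (intro psd_onI nonneg arg_cong[where f = exp] psd_onD_sym[OF K])
qed

section \<open>Schoenberg's theorem on a finite set\<close>

text \<open>Subtracting the total weight \<open>s\<close> at \<open>p0\<close> turns arbitrary weights into weights of total zero,
  and the form of \<open>- K\<close> at the latter is the form of the centred kernel at the former.\<close>

lemma psd_on_centred:
  assumes S: "finite S" "p0 \<in> S" and K: "cnd_on S K"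
  shows "psd_on S (\<lambda>p q. K p p0 + K p0 q - K p q - K p0 p0)"
proof -
  have sym: "K p q = K q p" if "p \<in> S" "q \<in> S" for p q
    using K that by (auto simp: cnd_on_def)
  have "0 \<le> quad_form S (\<lambda>p q. K p p0 + K p0 q - K p q - K p0 p0) c" for c
  proof -
    define s where "s = sum c S"
    let ?d = "\<lambda>p. c p - s * of_bool (p = p0)"
    have "sum ?d S = 0"
      using S by (simp add: sum_subtractf s_def flip: sum_distrib_left)
    then have "quad_form S K ?d \<le> 0"
      using K by (simp add: cnd_on_def)
    moreover have "quad_form S (\<lambda>p q. K p p0 + K p0 q - K p q - K p0 p0) c =
        quad_form S (\<lambda>p q. K p p0 * 1) c + quad_form S (\<lambda>p q. 1 * K p0 q) c
          - quad_form S K c - quad_form S (\<lambda>p q. K p0 p0) c"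
      by (simp add: quad_form_def algebra_simps sum.distrib sum_subtractf)
    ultimately show ?thesis
      unfolding quad_form_shift_at[OF S] quad_form_product quad_form_const
      by (simp add: s_def[symmetric] algebra_simps)
  qed
  then show ?thesis
    using sym S(2) by (intro psd_onI) simp_all
qed

lemma cnd_on_imp_psd_on_exp:
  assumes S: "finite S" and K: "cnd_on S K" and t: "0 < t"
  shows "psd_on S (\<lambda>p q. exp (- t * K p q))"
proof (cases "S = {}")
  case True
  then show ?thesis by (simp add: psd_on_def quad_form_def)
next
  case False
  then obtain p0 where p0: "p0 \<in> S" by blast
  define \<phi> where "\<phi> = (\<lambda>p q. K p p0 + K p0 q - K p q - K p0 p0)"
  have sym: "K p q = K q p" if "p \<in> S" "q \<in> S" for p q
    using K that by (auto simp: cnd_on_def)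
  have "psd_on S \<phi>"
    unfolding \<phi>_def by (rule psd_on_centred[OF S p0 K])
  then have "psd_on S (\<lambda>p q. t * \<phi> p q)"
    using t by (simp add: psd_on_def quad_form_scale)
  then have E: "psd_on S (\<lambda>p q. exp (t * \<phi> p q))"
    by (rule psd_on_exp[OF S])
  have "0 \<le> quad_form S (\<lambda>p q. exp (- t * K p q)) c" for c
  proof -
    have factor: "exp (- t * K p q) =
        exp (t * K p0 p0) * (exp (- t * K p p0) * exp (- t * K q p0) * exp (t * \<phi> p q))"
      if "p \<in> S" "q \<in> S" for p q
      using sym[OF p0 that(2)] by (simp add: \<phi>_def algebra_simps flip: exp_add)
    have "quad_form S (\<lambda>p q. exp (- t * K p q)) c =
        quad_form S (\<lambda>p q. exp (t * K p0 p0) * exp (t * \<phi> p q)) (\<lambda>p. c p * exp (- t * K p p0))"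
      by (rule quad_form_cong) (simp only: factor mult_ac)
    then show ?thesis
      using psd_onD_nonneg[OF E] by (simp add: quad_form_scale)
  qed
  then show ?thesis
    using sym by (intro psd_onI) simp_all
qed

lemma psd_on_exp_imp_cnd_on:
  assumes E: "\<And>t. 0 < t \<Longrightarrow> psd_on S (\<lambda>p q. exp (- t * K p q))"
  shows "cnd_on S K"
proof -
  have "quad_form S K c \<le> 0" if c: "sum c S = 0" for c
  proof -
    have entry: "((\<lambda>t. (exp (- t * K p q) - 1) / t) \<longlongrightarrow> - K p q) (at_right 0)" for p q
    proof -
      have "((\<lambda>t. exp (- t * K p q)) has_real_derivative - K p q) (at 0)"
        by (auto intro!: derivative_eq_intros)
      then show ?thesis
        unfolding has_field_derivative_iff
        by (auto intro: tendsto_within_subset)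
    qed
    have lim: "((\<lambda>t. quad_form S (\<lambda>p q. (exp (- t * K p q) - 1) / t) c)
        \<longlongrightarrow> quad_form S (\<lambda>p q. - K p q) c) (at_right 0)"
      unfolding quad_form_def by (intro tendsto_sum tendsto_mult_left entry)
    have "0 \<le> quad_form S (\<lambda>p q. (exp (- t * K p q) - 1) / t) c" if "0 < t" for t
    proof -
      have "quad_form S (\<lambda>p q. (exp (- t * K p q) - 1) / t) c =
          quad_form S (\<lambda>p q. exp (- t * K p q)) c / t"
        using quad_form_scale[of S "1 / t" "\<lambda>p q. exp (- t * K p q) - 1" c] c
        by (simp add: quad_form_diff quad_form_const)
      then show ?thesis
        using psd_onD_nonneg[OF E[OF that]] that by simp
    qed
    then have "0 \<le> quad_form S (\<lambda>p q. - K p q) c"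
      by (intro tendsto_lowerbound[OF lim]) (auto simp: eventually_at_right_less eventually_at_filter)
    then show ?thesis
      using quad_form_scale[of S "-1" K c] by simp
  qed
  moreover have "K p q = K q p" if "p \<in> S" "q \<in> S" for p q
    using psd_onD_sym[OF E[of 1] that] by simp
  ultimately show ?thesis
    unfolding cnd_on_def by blast
qed

section \<open>Matrix-valued functions as kernels\<close>

definition matrix_kernel ::
    "(nat \<Rightarrow> real^'d) \<Rightarrow> (real^'d \<Rightarrow> real^'m^'m) \<Rightarrow> nat \<times> 'm \<Rightarrow> nat \<times> 'm \<Rightarrow> real" where
  "matrix_kernel x C p q = C (x (fst p) - x (fst q)) $ snd p $ snd q"

lemma matrix_sum_eq_quad_form:
  "(\<Sum>i<n. \<Sum>j<n. a i \<bullet> (C (x i - x j) *v a j)) =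
     quad_form ({..<n} \<times> UNIV) (matrix_kernel x C) (\<lambda>(k, i). a k $ i)"
proof -
  have "(\<Sum>k<n. \<Sum>l<n. a k \<bullet> (C (x k - x l) *v a l)) =
      (\<Sum>k<n. \<Sum>l<n. \<Sum>i\<in>UNIV. \<Sum>j\<in>UNIV. a k $ i * a l $ j * C (x k - x l) $ i $ j)"
    by (simp add: inner_vec_def matrix_vector_mult_def sum_distrib_left mult_ac)
  also have "\<dots> = (\<Sum>k<n. \<Sum>i\<in>UNIV. \<Sum>l<n. \<Sum>j\<in>UNIV. a k $ i * a l $ j * C (x k - x l) $ i $ j)"
    by (intro sum.cong refl sum.swap)
  finally show ?thesis
    by (simp add: quad_form_def matrix_kernel_def sum.cartesian_product' case_prod_beta)
qed

lemma all_weights_iff: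
  "(\<forall>a :: nat \<Rightarrow> real^'m. P (\<lambda>(k, i). a k $ i)) \<longleftrightarrow> (\<forall>c. P c)"
proof (intro iffI allI)
  fix c :: "nat \<times> 'm \<Rightarrow> real"
  assume "\<forall>a :: nat \<Rightarrow> real^'m. P (\<lambda>(k, i). a k $ i)"
  then have "P (\<lambda>(k, i). (\<chi> i. c (k, i)) $ i)" by (rule spec[where x = "\<lambda>k. \<chi> i. c (k, i)"])
  then show "P c" by simp
qed auto

lemma vec_1_inner_sum:
  "(vec 1 :: real^'m) \<bullet> (\<Sum>k<n. a k) = sum (\<lambda>(k, i). a k $ i) ({..<n} \<times> UNIV)"
  unfolding sum.cartesian_product[symmetric]
  by (simp add: inner_vec_def sum.swap[of _ UNIV])

text \<open>A two-point configuration recovers the symmetry at every \<open>h\<close> from the symmetry of the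
  kernels.\<close>

lemma matrix_symmetric_iff:
  "(\<forall>h i j. C h $ i $ j = C (- h) $ j $ i) \<longleftrightarrow>
     (\<forall>n x. \<forall>p\<in>{..<n} \<times> UNIV. \<forall>q\<in>{..<n} \<times> UNIV. matrix_kernel x C p q = matrix_kernel x C q p)"
  (is "?L \<longleftrightarrow> ?R")
proof
  assume L: ?L
  show ?R
    unfolding matrix_kernel_def using L by (metis minus_diff_eq)
next
  assume R: ?R
  show ?L
  proof (intro allI)
    fix h i j
    show "C h $ i $ j = C (- h) $ j $ i"
      using R[rule_format, of "(1, i)" 2 "(0, j)" "\<lambda>k. if k = 1 then h else 0"]
      by (simp add: matrix_kernel_def)
  qed
qed

lemma positive_definite_iff_psd_on:
  "positive_definite C \<longleftrightarrow> (\<forall>n x. psd_on ({..<n} \<times> UNIV) (matrix_kernel x C))"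
  unfolding positive_definite_def psd_on_def matrix_symmetric_iff matrix_sum_eq_quad_form
    all_weights_iff[where P = "\<lambda>c. 0 \<le> quad_form _ _ c"]
  by blast

lemma conditionally_negative_definite_iff_cnd_on:
  "conditionally_negative_definite \<gamma> \<longleftrightarrow> (\<forall>n x. cnd_on ({..<n} \<times> UNIV) (matrix_kernel x \<gamma>))"
  unfolding conditionally_negative_definite_def cnd_on_def matrix_symmetric_iff
    matrix_sum_eq_quad_form vec_1_inner_sum
    all_weights_iff[where P = "\<lambda>c. sum c _ = 0 \<longrightarrow> quad_form _ _ c \<le> 0"]
  by blast

lemma matrix_kernel_exp_star:
  "matrix_kernel x (\<lambda>h. exp_star ((- t) *\<^sub>R \<gamma> h)) = (\<lambda>p q. exp (- t * matrix_kernel x \<gamma> p q))"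
  by (simp add: matrix_kernel_def exp_star_def fun_eq_iff)

theorem theorem3p2:
  fixes \<gamma> :: "real^'d \<Rightarrow> real^'m^'m"
  shows "conditionally_negative_definite \<gamma> \<longleftrightarrow>
    (\<forall>t::real. t > 0 \<longrightarrow> positive_definite (\<lambda>h. exp_star ((- t) *\<^sub>R \<gamma> h)))"
proof -
  have "cnd_on ({..<n} \<times> UNIV) (matrix_kernel x \<gamma>) \<longleftrightarrow>
      (\<forall>t>0. psd_on ({..<n} \<times> UNIV) (\<lambda>p q. exp (- t * matrix_kernel x \<gamma> p q)))" for n x
    by (rule iffI, intro allI impI cnd_on_imp_psd_on_exp)
       (simp_all add: psd_on_exp_imp_cnd_on)
  then show ?thesis
    unfolding conditionally_negative_definite_iff_cnd_on positive_definite_iff_psd_on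
      matrix_kernel_exp_star
    by blast
qed

end
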